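(* Consider $n$ time-based exponential histograms $EH_1,\dots,EH_n$, initialized with error parameter $\epsilon$ and covering the same time range of $N$ time units, where $EH_k$ summarizes stream $S_k$. The exponential histogram $EH_\oplus$ initialized with error parameter $\epsilon'$ and constructed from $EH_1,\dots,EH_n$ by the aggregation algorithm described in the context answers any query within its time range for the stream $S_\oplus=S_1\oplus\cdots\oplus S_n$ with a maximum relative error of $\epsilon+\epsilon'+\epsilon\epsilon'$. That is, if $i$ is the number of true bits of $S_\oplus$ in the query range and $\hat i$ is the answer computed from $EH_\oplus$, then $|\hat i-i|\le(\epsilon+\epsilon'+\epsilon\epsilon')\,i$.
   Context: Streams consist of time-stamped true bits. The order-preserving aggregation $S_\oplus=S_1\oplus\cdots\oplus S_n$ is the stream containing all bits of all $S_k$, preserving the ordering and arrival times. At current time $t$, a query for the last $q\le N$ time units has starting time $s_q=t-q$ and asks for the number of true bits arriving in the query range, i.e. at or after $s_q$. Exponential histogram with error parameter $\epsilon$ (time-based, window of $N$ time units): the window is broken into consecutive buckets of exponentially increasing sizes, numbered so that bucket $1$ is the most recent. The size $|b|$ of a bucket $b$ is the number of true bits that arrived in its range. Its ending time $e(b)$ is the time of its most recent true bit, and its starting time $s(b)$ is the ending time of the bucket immediately preceding it in time. Buckets that no longer overlap the window are discarded. Writing $C_j$ for the size of bucket $j$, the following invariant is maintained for all buckets $j$: $$\frac{C_j}{2\left(1+\sum_{m=1}^{j-1}C_m\right)}\le\epsilon .$$ A query is answered by summing the sizes of all buckets that fully overlap the query range, plus half of the size of the oldest bucket overlapping the query range if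 it overlaps it only partially. Aggregation algorithm: initialize an empty time-based exponential histogram $EH_\oplus$ with error parameter $\epsilon'$, configured to keep the last $N$ time units and a maximum of $\sum_{k=1}^n|EH_k|$ elements, where $|EH_k|$ is the number of elements in $EH_k$. For each bucket $b$ of each $EH_k$, simulate the insertion into $EH_\oplus$ of $|b|$ true bits, half of them with time stamp $s(b)$ and the other half with time stamp $e(b)$. The insertions, over all buckets of all $n$ histograms, are simulated in the order defined by the starting and ending time stamps of the buckets. *)

theory Defs
  imports Complex_Main
begin

text \<open>
  A stream is the list of arrival times of its true bits, in order of arrival; several bits may
  carry the same time stamp. Time is measured from the start of the streams, time 0.
\<close>

type_synonym stream = "real list"

definition stream_until :: "real \<Rightarrow> stream \<Rightarrow> bool" where
  "stream_until t S \<longleftrightarrow> sorted S \<and> (\<forall>\<tau>\<in>set S. 0 \<le> \<tau> \<and> \<tau> \<le> t)"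

definition aggregate_streams :: "nat \<Rightarrow> (nat \<Rightarrow> stream) \<Rightarrow> stream" where
  "aggregate_streams n S = sort (concat (map S [1..<Suc n]))"

definition bits_from :: "real \<Rightarrow> stream \<Rightarrow> nat" where
  "bits_from s S = length (filter (\<lambda>\<tau>. s \<le> \<tau>) S)"

datatype bucket = Bucket (bstart: real) (bend: real) (bsize: nat)

text \<open>
  The bucket sequence, oldest first, obtained by cutting a stream into nonempty consecutive
  groups of bits. The first argument is the ending time of the bucket immediately before the
  first group. A bucket that has no predecessor at all starts at time 0.
\<close>

fun buckets_of :: "real \<Rightarrow> real list list \<Rightarrow> bucket list" where
  "buckets_of s [] = []"
| "buckets_of s (g # gs) = Bucket s (last g) (length g) # buckets_of (last g) gs"

text \<open>
  From here on a histogram is the list of its buckets, most recent bucket first; position \<open>j\<close> of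
  the list is bucket \<open>j + 1\<close> in the customary numbering.

  \<open>\<not> single_exact\<close> is the invariant for all buckets without exception. For the most recent bucket
  it reads \<open>C / 2 \<le> \<epsilon>\<close>, so a nonempty histogram then needs \<open>\<epsilon> \<ge> 1/2\<close>. \<open>single_exact\<close> also covers
  smaller \<open>\<epsilon>\<close>: buckets holding a single bit are exempt from the invariant, and since the arrival
  time of that bit is the ending time of its bucket, the bit is counted exactly by a query.
\<close>

definition eh_invariant :: "bool \<Rightarrow> real \<Rightarrow> bucket list \<Rightarrow> bool" where
  "eh_invariant single_exact \<epsilon> H \<longleftrightarrow>
     (\<forall>j<length H. (single_exact \<and> bsize (H ! j) = 1) \<or>
        real (bsize (H ! j)) / (2 * (1 + (\<Sum>m<j. real (bsize (H ! m))))) \<le> \<epsilon>)"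

text \<open>The usual histogram has base \<open>\<beta> = 2\<close>. Several buckets may share the same size.\<close>

definition exponential_sizes :: "bucket list \<Rightarrow> bool" where
  "exponential_sizes H \<longleftrightarrow>
     sorted (map bsize H) \<and> (\<exists>\<beta>::nat\<ge>2. \<forall>b\<in>set H. \<exists>r. bsize b = \<beta> ^ r)"

text \<open>
  \<open>H\<close> is a possible state, at time \<open>t\<close>, of a time-based exponential histogram over a window of \<open>N\<close>
  time units into which the bits of \<open>S\<close> have been inserted. The groups \<open>gs\<close> comprise the discarded
  buckets too, because the oldest remaining bucket starts where its discarded predecessor ended.
\<close>

definition exponential_histogram ::
  "bool \<Rightarrow> real \<Rightarrow> real \<Rightarrow> real \<Rightarrow> stream \<Rightarrow> bucket list \<Rightarrow> bool" where
  "exponential_histogram single_exact \<epsilon> N t S H \<longleftrightarrow>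
     (\<exists>gs. concat gs = S \<and> [] \<notin> set gs \<and>
           H = rev (filter (\<lambda>b. t - N \<le> bend b) (buckets_of 0 gs))) \<and>
     exponential_sizes H \<and>
     eh_invariant single_exact \<epsilon> H"

definition overlaps :: "real \<Rightarrow> bucket \<Rightarrow> bool" where
  "overlaps s b \<longleftrightarrow> s \<le> bend b"

definition fully_overlaps :: "real \<Rightarrow> bucket \<Rightarrow> bool" where
  "fully_overlaps s b \<longleftrightarrow> s \<le> bstart b"

definition partial_count :: "bool \<Rightarrow> bucket \<Rightarrow> real" where
  "partial_count single_exact b =
     (if single_exact \<and> bsize b = 1 then 1 else real (bsize b) / 2)"

text \<open>The answer to a query with starting time \<open>s\<close>; \<open>last\<close> picks the oldest overlapping bucket.\<close>

definition eh_answer :: "bool \<Rightarrow> real \<Rightarrow> bucket list \<Rightarrow> real" where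
  "eh_answer single_exact s H =
     (\<Sum>b\<leftarrow>filter (fully_overlaps s) H. real (bsize b)) +
     (let V = filter (overlaps s) H
      in if V \<noteq> [] \<and> \<not> fully_overlaps s (last V) then partial_count single_exact (last V) else 0)"

text \<open>
  For a bucket of odd size (with base 2: a single-bit bucket) the odd bit goes to the ending time,
  at which the most recent bit of the bucket did arrive.
\<close>

definition simulated_bits :: "bucket \<Rightarrow> stream" where
  "simulated_bits b =
     replicate (bsize b div 2) (bstart b) @ replicate (bsize b - bsize b div 2) (bend b)"

definition simulated_stream :: "nat \<Rightarrow> (nat \<Rightarrow> bucket list) \<Rightarrow> stream" where
  "simulated_stream n EH = sort (concat (map simulated_bits (concat (map EH [1..<Suc n]))))"

definition eh_elements :: "bucket list \<Rightarrow> nat" where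
  "eh_elements H = sum_list (map bsize H)"

text \<open>
  \<open>H\<close> is a possible result of the aggregation of \<open>EH 1, \<dots>, EH n\<close> at time \<open>t\<close>. Exactly as many
  bits are inserted as the capacity allows, so the capacity never forces anything out.
\<close>

definition aggregated_histogram ::
  "bool \<Rightarrow> real \<Rightarrow> real \<Rightarrow> real \<Rightarrow> nat \<Rightarrow> (nat \<Rightarrow> bucket list) \<Rightarrow> bucket list \<Rightarrow> bool" where
  "aggregated_histogram single_exact \<epsilon>' N t n EH H \<longleftrightarrow>
     exponential_histogram single_exact \<epsilon>' N t (simulated_stream n EH) H \<and>
     eh_elements H \<le> (\<Sum>k=1..n. eh_elements (EH k))"

end

theory Submission
  imports Defs
begin

text \<open>
  At most one bucket of a histogram straddles the query start, and all more recent ones lie in the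
  query range. So only the straddling bucket is estimated, with an error of at most half its size,
  and the query range contains at least one of its bits besides all more recent buckets: by the
  invariant the relative error is at most the error parameter. This applies to the answer computed
  from any histogram, and equally to the number of simulated bits in the query range, since the
  simulation puts half of the straddling bucket inside the range. The two relative errors compose.
\<close>

section \<open>Counting bits in a query range\<close>

lemma bits_from_append: "bits_from s (xs @ ys) = bits_from s xs + bits_from s ys"
  by (simp add: bits_from_def)

lemma bits_from_concat: "bits_from s (concat xss) = sum_list (map (bits_from s) xss)"
  by (induction xss) (simp_all add: bits_from_append, simp add: bits_from_def)

lemma bits_from_sort: "bits_from s (sort xs) = bits_from s xs"
  using filter_sort[of "(\<le>) s" "\<lambda>x. x" xs] by (simp add: bits_from_def)

lemma bits_from_eq_length: "(\<And>x. x \<in> set xs \<Longrightarrow> s \<le> x) \<Longrightarrow> bits_from s xs = length xs"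
  by (simp add: bits_from_def filter_id_conv)

lemma bits_from_eq_0: "(\<And>x. x \<in> set xs \<Longrightarrow> x < s) \<Longrightarrow> bits_from s xs = 0"
  by (auto simp: bits_from_def filter_empty_conv not_le)

lemma sorted_le_last: "sorted xs \<Longrightarrow> x \<in> set xs \<Longrightarrow> x \<le> last xs"
  by (induction xs) auto

section \<open>Buckets cut from a sorted stream\<close>

lemma buckets_of_bounds:
  assumes "sorted (concat gs)" "[] \<notin> set gs" "\<And>x. x \<in> set (concat gs) \<Longrightarrow> a \<le> x"
    and "b \<in> set (buckets_of a gs)"
  shows "a \<le> bstart b \<and> bstart b \<le> bend b"
  using assms
proof (induction gs arbitrary: a)
  case (Cons g gs)
  \<comment> \<open>The ending time is itself an arrival time, so it is at least \<open>a\<close>;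
    sortedness makes it the lower bound for the remaining groups.\<close>
  have g: "g \<noteq> []" "last g \<in> set g" using Cons.prems(2) by auto
  then have a: "a \<le> last g" using Cons.prems(3) by simp
  show ?case
  proof (cases "b \<in> set (buckets_of (last g) gs)")
    case True
    have "last g \<le> bstart b \<and> bstart b \<le> bend b"
      using Cons.prems(1,2) g True by (intro Cons.IH) (auto simp: sorted_append)
    then show ?thesis using a by linarith
  next
    case False
    then show ?thesis using Cons.prems(4) a by simp
  qed
qed simp

lemma bits_from_eq_sum_buckets:
  assumes "[] \<notin> set gs" "\<And>x. x \<in> set (concat gs) \<Longrightarrow> s \<le> x"
  shows "bits_from s (concat gs) = sum_list (map bsize (buckets_of a gs))"
  using assms
proof (induction gs arbitrary: a)
  case (Cons g gs)
  then show ?case by (simp add: bits_from_append bits_from_eq_length)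
qed (simp add: bits_from_def)

text \<open>Each bucket starts where its predecessor ends, so at most one bucket starts before
  \<open>s\<close> and ends at or after \<open>s\<close>; if there is one, it forms
  \<open>P\<close>. \<open>D\<close> holds the older buckets and \<open>F\<close> the more recent
  ones. Of the contribution \<open>x\<close> of \<open>P\<close> only a range is known.\<close>

lemma buckets_of_split:
  assumes "sorted (concat gs)" "[] \<notin> set gs" "\<And>x. x \<in> set (concat gs) \<Longrightarrow> a \<le> x"
  obtains D P F x where
    "buckets_of a gs = D @ P @ F"
    "\<forall>b\<in>set D. \<not> overlaps s b" "\<forall>b\<in>set F. fully_overlaps s b"
    "P = [] \<and> x = 0 \<or>
      (\<exists>b. P = [b] \<and> overlaps s b \<and> \<not> fully_overlaps s b \<and> 1 \<le> x \<and> x \<le> bsize b)"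
    "bits_from s (concat gs) = x + sum_list (map bsize F)"
  using assms
proof (induction gs arbitrary: a thesis)
  case Nil
  show ?case by (rule Nil.prems(1)[of "[]" "[]" "[]" 0]) (simp_all add: bits_from_def)
next
  case (Cons g gs)
  note prems = Cons.prems(2-)
  have g: "g \<noteq> []" "last g \<in> set g" "sorted g" using prems(1,2) by (auto simp: sorted_append)
  have tail: "sorted (concat gs)" "[] \<notin> set gs" "\<And>x. x \<in> set (concat gs) \<Longrightarrow> last g \<le> x"
    using prems(1,2) g by (auto simp: sorted_append)
  let ?b = "Bucket a (last g) (length g)"
  \<comment> \<open>The query starts no later than the first bucket, within it, or after its end;
    only the last case needs the induction hypothesis.\<close>
  consider "s \<le> a" | "a < s" "s \<le> last g" | "last g < s" by linarith
  then show ?case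
  proof cases
    case 1
    have "fully_overlaps s b" if "b \<in> set (buckets_of a (g # gs))" for b
      using buckets_of_bounds[OF prems that] 1 by (simp add: fully_overlaps_def)
    moreover have "bits_from s (concat (g # gs)) = sum_list (map bsize (buckets_of a (g # gs)))"
      using 1 prems(2,3) by (intro bits_from_eq_sum_buckets) (auto intro: order_trans)
    ultimately show ?thesis
      by (intro Cons.prems(1)[of "[]" "[]" "buckets_of a (g # gs)" 0]) simp_all
  next
    case 2
    have "fully_overlaps s b" if "b \<in> set (buckets_of (last g) gs)" for b
      using buckets_of_bounds[OF tail that] 2 by (simp add: fully_overlaps_def)
    moreover have "bits_from s (concat gs) = sum_list (map bsize (buckets_of (last g) gs))"
      using 2 tail(2,3) by (intro bits_from_eq_sum_buckets) (auto intro: order_trans)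
    \<comment> \<open>The last bit of the straddling bucket arrives at its ending time, hence in the
      query range; this is the source of \<open>1 \<le> x\<close>.\<close>
    moreover have "last g \<in> set (filter (\<lambda>x. s \<le> x) g)" using 2 g by simp
    then have "1 \<le> bits_from s g"
      unfolding bits_from_def by (metis One_nat_def Suc_leI length_pos_if_in_set)
    moreover have "bits_from s g \<le> length g" by (simp add: bits_from_def)
    ultimately show ?thesis using 2
      by (intro Cons.prems(1)[of "[]" "[?b]" "buckets_of (last g) gs" "bits_from s g"])
        (simp_all add: bits_from_append overlaps_def fully_overlaps_def)
  next
    case 3
    obtain D P F x where split:
      "buckets_of (last g) gs = D @ P @ F"
      "\<forall>b\<in>set D. \<not> overlaps s b" "\<forall>b\<in>set F. fully_overlaps s b"
      "P = [] \<and> x = 0 \<or>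
        (\<exists>b. P = [b] \<and> overlaps s b \<and> \<not> fully_overlaps s b \<and> 1 \<le> x \<and> x \<le> bsize b)"
      "bits_from s (concat gs) = x + sum_list (map bsize F)"
      using Cons.IH[OF _ tail] by blast
    have "bits_from s g = 0"
      using 3 sorted_le_last[OF g(3)] by (intro bits_from_eq_0) fastforce
    then show ?thesis using split 3
      by (intro Cons.prems(1)[of "?b # D" P F x]) (simp_all add: bits_from_append overlaps_def)
  qed
qed

section \<open>Histograms restricted to the window\<close>

lemma exponential_histogram_bounds:
  assumes "exponential_histogram se \<epsilon> N t S H" "sorted S" "\<forall>x\<in>set S. 0 \<le> x" "b \<in> set H"
  shows "0 \<le> bstart b \<and> bstart b \<le> bend b"
proof -
  obtain gs where "concat gs = S" "[] \<notin> set gs"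
    "H = rev (filter (\<lambda>b. t - N \<le> bend b) (buckets_of 0 gs))"
    using assms(1) unfolding exponential_histogram_def by blast
  with assms show ?thesis by (intro buckets_of_bounds[of gs]) auto
qed

text \<open>A discarded bucket ends before \<open>t - N \<le> s\<close> and so cannot overlap the
  query. Discarding therefore only thins out \<open>D\<close>, and the count still refers to the
  whole stream.\<close>

lemma exponential_histogram_split:
  assumes H: "exponential_histogram se \<epsilon> N t S H" and S: "sorted S" "\<forall>x\<in>set S. 0 \<le> x"
    and s: "t - N \<le> s"
  obtains F P D x where
    "H = F @ P @ D"
    "\<forall>b\<in>set D. \<not> overlaps s b \<and> \<not> fully_overlaps s b"
    "\<forall>b\<in>set F. overlaps s b \<and> fully_overlaps s b"
    "P = [] \<and> x = 0 \<or>
      (\<exists>b. P = [b] \<and> overlaps s b \<and> \<not> fully_overlaps s b \<and> 1 \<le> x \<and> x \<le> bsize b)"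
    "bits_from s S = x + sum_list (map bsize F)"
proof -
  obtain gs where gs: "concat gs = S" "[] \<notin> set gs"
    and H_eq: "H = rev (filter (\<lambda>b. t - N \<le> bend b) (buckets_of 0 gs))"
    using H unfolding exponential_histogram_def by blast
  have gs': "sorted (concat gs)" "\<And>x. x \<in> set (concat gs) \<Longrightarrow> 0 \<le> x"
    using gs(1) S by simp_all
  obtain D P F x where split:
    "buckets_of 0 gs = D @ P @ F"
    "\<forall>b\<in>set D. \<not> overlaps s b" "\<forall>b\<in>set F. fully_overlaps s b"
    "P = [] \<and> x = 0 \<or>
      (\<exists>b. P = [b] \<and> overlaps s b \<and> \<not> fully_overlaps s b \<and> 1 \<le> x \<and> x \<le> bsize b)"
    "bits_from s (concat gs) = x + sum_list (map bsize F)"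
    using buckets_of_split[OF gs'(1) gs(2) gs'(2)] by metis
  have full: "overlaps s b" if "b \<in> set (D @ P @ F)" "fully_overlaps s b" for b
    using buckets_of_bounds[OF gs'(1) gs(2) gs'(2), of b] that split(1)
    by (auto simp: overlaps_def fully_overlaps_def)
  let ?kept = "filter (\<lambda>b. t - N \<le> bend b)"
  have kept: "t - N \<le> bend b" if "overlaps s b" for b
    using that s by (simp add: overlaps_def)
  have "?kept F = F" using split(3) full kept by (simp add: filter_id_conv)
  moreover have "?kept P = P" using split(4) kept by auto
  ultimately have "H = rev F @ P @ rev (?kept D)"
    using H_eq split(1,4) by auto
  then show thesis
    using split(2-) gs(1) full
    by (intro that[of "rev F" P "rev (?kept D)" x]) (auto simp: sum_list_rev rev_map[symmetric])
qed

section \<open>Relative error of bucketwise estimates\<close>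

text \<open>Common form of the two ways in which a bucket is counted: by the query answer and by its
  simulated bits. The upper bound \<open>(bsize b + 1) / 2\<close> for a straddling bucket leaves
  room for the odd bit that the simulation places at the ending time. Buckets that start at or after
  \<open>s\<close> but end before it are left unconstrained, as no histogram contains one.\<close>

definition estimated_count :: "bool \<Rightarrow> real \<Rightarrow> (bucket \<Rightarrow> real) \<Rightarrow> bool" where
  "estimated_count se s c \<longleftrightarrow> (\<forall>b.
     (fully_overlaps s b \<and> overlaps s b \<longrightarrow> c b = real (bsize b)) \<and>
     (\<not> fully_overlaps s b \<and> \<not> overlaps s b \<longrightarrow> c b = 0) \<and>
     (\<not> fully_overlaps s b \<and> overlaps s b \<longrightarrow>
       real (bsize b) / 2 \<le> c b \<and> 2 * c b \<le> real (bsize b) + 1 \<and>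
       (se \<and> bsize b = 1 \<longrightarrow> c b = 1)))"

lemma estimated_count_error:
  assumes H: "exponential_histogram se \<epsilon> N t S H" and S: "sorted S" "\<forall>x\<in>set S. 0 \<le> x"
    and s: "t - N \<le> s" and "0 \<le> \<epsilon>" and c: "estimated_count se s c"
  shows "\<bar>sum_list (map c H) - real (bits_from s S)\<bar> \<le> \<epsilon> * real (bits_from s S)"
proof -
  obtain F P D x where split: "H = F @ P @ D"
    "\<forall>b\<in>set D. \<not> overlaps s b \<and> \<not> fully_overlaps s b"
    "\<forall>b\<in>set F. overlaps s b \<and> fully_overlaps s b"
    "P = [] \<and> x = 0 \<or>
      (\<exists>b. P = [b] \<and> overlaps s b \<and> \<not> fully_overlaps s b \<and> 1 \<le> x \<and> x \<le> bsize b)"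
    and i: "bits_from s S = x + sum_list (map bsize F)"
    by (rule exponential_histogram_split[OF H S s])
  let ?F = "sum_list (map bsize F)"
  have cF: "map c F = map (\<lambda>b. real (bsize b)) F"
    using split(3) c by (simp add: estimated_count_def)
  have F: "sum_list (map c F) = real ?F"
    unfolding cF by (induction F) auto
  have cD: "map c D = map (\<lambda>b. 0) D"
    using split(2) c by (simp add: estimated_count_def)
  have D: "sum_list (map c D) = 0"
    unfolding cD by simp
  have total: "sum_list (map c H) - real (bits_from s S) = sum_list (map c P) - real x"
    using split(1) F D i by simp
  consider "P = []" "x = 0"
    | b where "P = [b]" "overlaps s b" "\<not> fully_overlaps s b" "1 \<le> x" "x \<le> bsize b"
    using split(4) by blast
  then show ?thesis
  proof cases
    case 1
    then show ?thesis unfolding total using \<open>0 \<le> \<epsilon>\<close> by simp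
  next
    case 2
    have cb: "real (bsize b) / 2 \<le> c b" "2 * c b \<le> real (bsize b) + 1"
      "se \<Longrightarrow> bsize b = 1 \<Longrightarrow> c b = 1"
      using c 2 by (auto simp: estimated_count_def)
    show ?thesis
    \<comment> \<open>A bucket exempt from the invariant has size 1, which forces
      \<open>x = 1\<close>; \<open>c\<close> counts it as 1 too, so the error is zero.\<close>
    proof (cases "se \<and> bsize b = 1")
      case True
      then show ?thesis unfolding total using 2 cb \<open>0 \<le> \<epsilon>\<close> by simp
    next
      case False
      \<comment> \<open>The straddling bucket sits right after \<open>F\<close>, so the partial sum
        in its invariant is the total size of \<open>F\<close>.\<close>
      have nth: "H ! length F = b" "length F < length H" using split(1) 2 by simp_all
      have "(\<Sum>m<length F. real (bsize (H ! m))) = (\<Sum>m<length F. real (bsize (F ! m)))"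
        using split(1) by (intro sum.cong) (simp_all add: nth_append)
      also have "\<dots> = real ?F"
        by (simp add: sum_list_sum_nth atLeast0LessThan)
      finally have recent: "(\<Sum>m<length F. real (bsize (H ! m))) = real ?F" .
      have "real (bsize b) / (2 * (1 + real ?F)) \<le> \<epsilon>"
        using H nth False recent unfolding exponential_histogram_def eh_invariant_def by metis
      then have inv: "real (bsize b) / 2 \<le> \<epsilon> * (1 + real ?F)"
        by (simp add: field_simps add_pos_nonneg)
      \<comment> \<open>An overestimate is at most \<open>(bsize b + 1) / 2 - 1\<close>, because
        \<open>1 \<le> x\<close>: the rounding allowance in \<open>c\<close> is absorbed.\<close>
      have "\<bar>c b - real x\<bar> \<le> real (bsize b) / 2"
        using cb(1,2) \<open>1 \<le> x\<close> \<open>x \<le> bsize b\<close> by linarith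
      also have "\<dots> \<le> \<epsilon> * (1 + real ?F)" by (rule inv)
      \<comment> \<open>The 1 in the denominator of the invariant is matched by the bit of the
        straddling bucket known to be in range.\<close>
      also have "\<dots> \<le> \<epsilon> * real (bits_from s S)"
        using 2 i \<open>0 \<le> \<epsilon>\<close> by (intro mult_left_mono) simp_all
      finally show ?thesis unfolding total using 2 by simp
    qed
  qed
qed

lemma eh_answer_error:
  assumes H: "exponential_histogram se \<epsilon> N t S H" and S: "sorted S" "\<forall>x\<in>set S. 0 \<le> x"
    and s: "t - N \<le> s" and "0 \<le> \<epsilon>"
  shows "\<bar>eh_answer se s H - real (bits_from s S)\<bar> \<le> \<epsilon> * real (bits_from s S)"
proof -
  let ?c = "\<lambda>b. if fully_overlaps s b then real (bsize b)
    else if overlaps s b then partial_count se b else 0"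
  obtain F P D x where split: "H = F @ P @ D"
    "\<forall>b\<in>set D. \<not> overlaps s b \<and> \<not> fully_overlaps s b"
    "\<forall>b\<in>set F. overlaps s b \<and> fully_overlaps s b"
    "P = [] \<and> x = 0 \<or>
      (\<exists>b. P = [b] \<and> overlaps s b \<and> \<not> fully_overlaps s b \<and> 1 \<le> x \<and> x \<le> bsize b)"
    "bits_from s S = x + sum_list (map bsize F)"
    by (rule exponential_histogram_split[OF H S s])
  have "filter (overlaps s) F = F" "filter (fully_overlaps s) F = F"
    "filter (overlaps s) D = []" "filter (fully_overlaps s) D = []"
    using split(2,3) by (simp_all add: filter_id_conv filter_empty_conv)
  moreover have "map ?c D = map (\<lambda>b. 0) D"
    using split(2) by simp
  then have "sum_list (map ?c D) = 0" by (simp only: sum_list_0)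
  moreover have "map ?c F = map (\<lambda>b. real (bsize b)) F"
    using split(3) by simp
  then have "sum_list (map ?c F) = (\<Sum>b\<leftarrow>F. real (bsize b))" by (simp only:)
  \<comment> \<open>Without a straddling bucket, the oldest overlapping bucket is
    \<open>last F\<close>, and the half-bucket term of the answer vanishes.\<close>
  moreover have "F \<noteq> [] \<Longrightarrow> fully_overlaps s (last F)" using split(3) by simp
  ultimately have "eh_answer se s H = sum_list (map ?c H)"
    using split(4) unfolding eh_answer_def split(1) Let_def map_append sum_list_append
    by auto
  moreover have "estimated_count se s ?c"
    by (auto simp: estimated_count_def partial_count_def)
  ultimately show ?thesis
    using estimated_count_error[OF assms] by simp
qed

text \<open>The copies at the starting time count exactly when the bucket fully overlaps, those at
  the ending time exactly when it overlaps. A straddling bucket thus contributes half its size,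
  rounded up, which is exactly 1 for a single bit.\<close>

lemma estimated_count_simulated_bits:
  "estimated_count se s (\<lambda>b. real (bits_from s (simulated_bits b)))"
proof -
  have "bits_from s (simulated_bits b) =
      (if fully_overlaps s b then bsize b div 2 else 0) +
      (if overlaps s b then bsize b - bsize b div 2 else 0)" for b
    by (auto simp: bits_from_def simulated_bits_def overlaps_def fully_overlaps_def)
  then show ?thesis
    by (auto simp: estimated_count_def)
qed

section \<open>Combining the histograms and composing the errors\<close>

lemma sum_list_relative_error:
  fixes f g :: "'a \<Rightarrow> real"
  assumes "\<And>k. k \<in> set ks \<Longrightarrow> \<bar>f k - g k\<bar> \<le> \<epsilon> * g k"
  shows "\<bar>sum_list (map f ks) - sum_list (map g ks)\<bar> \<le> \<epsilon> * sum_list (map g ks)"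
  using assms
proof (induction ks)
  case (Cons k ks)
  have "\<bar>f k - g k\<bar> \<le> \<epsilon> * g k"
    "\<bar>sum_list (map f ks) - sum_list (map g ks)\<bar> \<le> \<epsilon> * sum_list (map g ks)"
    using Cons by simp_all
  then show ?case by (simp add: distrib_left)
qed simp

lemma of_nat_sum_list_map: "real (sum_list (map f xs)) = sum_list (map (\<lambda>x. real (f x)) xs)"
  by (induction xs) auto

lemma sum_list_concat: "sum_list (concat xss) = sum_list (map sum_list xss)"
  by (induction xss) simp_all

lemma bits_from_aggregate_streams:
  "real (bits_from s (aggregate_streams n S)) = (\<Sum>k\<leftarrow>[1..<Suc n]. real (bits_from s (S k)))"
  by (simp add: aggregate_streams_def bits_from_sort bits_from_concat of_nat_sum_list_map comp_def
      del: upt_Suc)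

lemma bits_from_simulated_stream:
  "real (bits_from s (simulated_stream n EH)) =
    (\<Sum>k\<leftarrow>[1..<Suc n]. \<Sum>b\<leftarrow>EH k. real (bits_from s (simulated_bits b)))"
  by (simp add: simulated_stream_def bits_from_sort bits_from_concat of_nat_sum_list_map comp_def
      map_concat sum_list_concat del: upt_Suc)

theorem theorem4:
  fixes n :: nat and S :: "nat \<Rightarrow> stream" and EH :: "nat \<Rightarrow> bucket list" and EH_agg :: "bucket list"
    and \<epsilon> \<epsilon>' N t q :: real and single_exact :: bool
  assumes "0 < \<epsilon>" and "0 < \<epsilon>'"
    and "\<And>k. k \<in> {1..n} \<Longrightarrow> stream_until t (S k)"
    and "\<And>k. k \<in> {1..n} \<Longrightarrow> exponential_histogram single_exact \<epsilon> N t (S k) (EH k)"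
    and "aggregated_histogram single_exact \<epsilon>' N t n EH EH_agg"
    and "0 \<le> q" and "q \<le> N"
  shows "\<bar>eh_answer single_exact (t - q) EH_agg - real (bits_from (t - q) (aggregate_streams n S))\<bar>
           \<le> (\<epsilon> + \<epsilon>' + \<epsilon> * \<epsilon>') * real (bits_from (t - q) (aggregate_streams n S))"
proof -
  let ?s = "t - q"
  let ?i = "real (bits_from ?s (aggregate_streams n S))"
  let ?i' = "real (bits_from ?s (simulated_stream n EH))"
  let ?a = "eh_answer single_exact ?s EH_agg"
  have s: "t - N \<le> ?s" using \<open>q \<le> N\<close> by simp
  have S: "sorted (S k)" "\<forall>x\<in>set (S k). 0 \<le> x" if "k \<in> {1..n}" for k
    using assms(3)[OF that] by (auto simp: stream_until_def)
  \<comment> \<open>Simulated time stamps include bucket starts, which need not be arrival times;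
    they must still be nonnegative for the simulated stream to be cut into buckets from time
    0.\<close>
  have "0 \<le> bstart b \<and> bstart b \<le> bend b" if "b \<in> set (EH k)" "k \<in> {1..n}" for b k
    using exponential_histogram_bounds[OF assms(4)[OF that(2)] S[OF that(2)] that(1)] .
  then have nonneg: "\<forall>x\<in>set (simulated_stream n EH). 0 \<le> x"
    by (fastforce simp: simulated_stream_def simulated_bits_def)
  have input: "\<bar>?i' - ?i\<bar> \<le> \<epsilon> * ?i"
    unfolding bits_from_aggregate_streams bits_from_simulated_stream
  proof (rule sum_list_relative_error)
    fix k assume "k \<in> set [1..<Suc n]"
    then have k: "k \<in> {1..n}" by auto
    show "\<bar>(\<Sum>b\<leftarrow>EH k. real (bits_from ?s (simulated_bits b))) - real (bits_from ?s (S k))\<bar>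
        \<le> \<epsilon> * real (bits_from ?s (S k))"
      using estimated_count_error[OF assms(4)[OF k] S[OF k] s _ estimated_count_simulated_bits]
        \<open>0 < \<epsilon>\<close> by simp
  qed
  have "exponential_histogram single_exact \<epsilon>' N t (simulated_stream n EH) EH_agg"
    using assms(5) by (simp add: aggregated_histogram_def)
  then have answer: "\<bar>?a - ?i'\<bar> \<le> \<epsilon>' * ?i'"
    using eh_answer_error[OF _ _ nonneg s] \<open>0 < \<epsilon>'\<close> by (simp add: simulated_stream_def)
  have "\<bar>?a - ?i\<bar> \<le> \<bar>?a - ?i'\<bar> + \<bar>?i' - ?i\<bar>" by linarith
  also have "\<dots> \<le> \<epsilon>' * ?i' + \<epsilon> * ?i" using answer input by linarith
  \<comment> \<open>The second error is relative to the simulated count, which may exceed the true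
    one by a factor \<open>1 + \<epsilon>\<close>; this yields the product term.\<close>
  also have "\<dots> \<le> \<epsilon>' * (?i + \<epsilon> * ?i) + \<epsilon> * ?i"
    using input \<open>0 < \<epsilon>'\<close> by (intro add_right_mono mult_left_mono) linarith+
  also have "\<dots> = (\<epsilon> + \<epsilon>' + \<epsilon> * \<epsilon>') * ?i" by (simp add: algebra_simps)
  finally show ?thesis .
qed

end
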